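(* Let $S=(S_0,\dots,S_{N-1})$, $\tilde S=(\tilde S_0,\dots,\tilde S_{N-1})$ be a biorthogonal wavelet representation with invertible-loop matrix functions $A$, $\tilde A$. Then for $f\in L^2(\mathbb{T})$ and $0\le i,j\le N-1$ we have (for almost every $z\in\mathbb{T}$) (i) $S_i^*S_jf(z)=(AA^* )_{j,i}(z)\,f(z)$, and (ii) $\tilde S_i^*\tilde S_jf(z)=(AA^* )^{-1}_{j,i}(z)\,f(z)$.
   Context: $\mathbb{T}$ is the unit circle with normalized Haar measure; $N\ge2$ is an integer. A biorthogonal wavelet representation on $L^2(\mathbb{T})$ is a system of operators $(S_if)(z)=m_i(z)f(z^N)$, $(\tilde S_if)(z)=\tilde m_i(z)f(z^N)$, $0\le i\le N-1$, with $m_i,\tilde m_i\in L^\infty(\mathbb{T})$, satisfying $S_i^*\tilde S_j=\delta_{i,j}I$ and $\sum_{i=0}^{N-1}S_i\tilde S_i^*=I$. Its invertible-loop matrix functions $A=(A_{k,l})_{k,l=0}^{N-1}$, $\tilde A=(\tilde A_{k,l})_{k,l=0}^{N-1}$ are $A_{k,l}(z)=\frac1N\sum_{w^N=z}w^{-l}m_k(w)$ and $\tilde A_{k,l}(z)=\frac1N\sum_{w^N=z}w^{-l}\tilde m_k(w)$; they satisfy $\tilde A(z)=(A(z)^* )^{-1}$ for a.e. $z$. $AA^*$ denotes the pointwise product $A(z)A(z)^*$, and $(AA^* )^{-1}_{j,i}$ is the $(j,i)$ entry of the pointwise inverse matrix. *)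

theory Defs
  imports
    "HOL-Analysis.Analysis"
    "Jordan_Normal_Form.Gauss_Jordan_Elimination"
    "Jordan_Normal_Form.Schur_Decomposition"
begin

text \<open>
  Normalized Haar measure on the unit circle: the image of Lebesgue measure on \<open>[0, 1)\<close>
  under \<open>t \<mapsto> exp (2 \<pi> i t)\<close>.  Its space is the circle itself, so almost-everywhere
  statements and measurability only concern points of modulus one.
\<close>

definition circle_measure :: "complex measure" where
  "circle_measure =
     distr (restrict_space lborel {0..<1}) (restrict_space borel (sphere 0 1))
       (\<lambda>t. cis (2 * pi * t))"

text \<open>
  Elements of \<open>L\<^sup>2\<close> and \<open>L\<^sup>\<infinity>\<close> are handled through representing functions; equality of
  elements is equality almost everywhere and is written out as such.
\<close>

definition L2_circle :: "(complex \<Rightarrow> complex) set" where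
  "L2_circle = {f \<in> borel_measurable circle_measure.
     integrable circle_measure (\<lambda>z. (norm (f z))\<^sup>2)}"

definition Linf_circle :: "(complex \<Rightarrow> complex) set" where
  "Linf_circle = {m \<in> borel_measurable circle_measure.
     \<exists>C. AE z in circle_measure. norm (m z) \<le> C}"

definition L2_inner :: "(complex \<Rightarrow> complex) \<Rightarrow> (complex \<Rightarrow> complex) \<Rightarrow> complex" where
  "L2_inner f g = (LINT z|circle_measure. f z * cnj (g z))"

text \<open>
  The Hilbert space adjoint.  The defining property determines the value at a given \<open>f\<close>
  only up to a null set; the choice operator selects one representative.
\<close>

definition L2_adjoint ::
  "((complex \<Rightarrow> complex) \<Rightarrow> (complex \<Rightarrow> complex)) \<Rightarrow> (complex \<Rightarrow> complex) \<Rightarrow> (complex \<Rightarrow> complex)"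
where
  "L2_adjoint T f =
     (SOME g. g \<in> L2_circle \<and> (\<forall>h\<in>L2_circle. L2_inner (T h) f = L2_inner h g))"

definition wavelet_op ::
  "nat \<Rightarrow> (complex \<Rightarrow> complex) \<Rightarrow> (complex \<Rightarrow> complex) \<Rightarrow> (complex \<Rightarrow> complex)"
where
  "wavelet_op N m f = (\<lambda>z. m z * f (z ^ N))"

text \<open>
  The system is given by its filters: \<open>m i\<close> for \<open>S\<^sub>i\<close> and \<open>mt i\<close> for the dual operator.
\<close>

definition biorthogonal_wavelet_rep ::
  "nat \<Rightarrow> (nat \<Rightarrow> complex \<Rightarrow> complex) \<Rightarrow> (nat \<Rightarrow> complex \<Rightarrow> complex) \<Rightarrow> bool"
where
  "biorthogonal_wavelet_rep N m mt \<longleftrightarrow>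
     (\<forall>i<N. m i \<in> Linf_circle \<and> mt i \<in> Linf_circle) \<and>
     (\<forall>i<N. \<forall>j<N. \<forall>f\<in>L2_circle. AE z in circle_measure.
        L2_adjoint (wavelet_op N (m i)) (wavelet_op N (mt j) f) z = (if i = j then f z else 0)) \<and>
     (\<forall>f\<in>L2_circle. AE z in circle_measure.
        (\<Sum>i<N. wavelet_op N (m i) (L2_adjoint (wavelet_op N (mt i)) f) z) = f z)"

definition loop_matrix :: "nat \<Rightarrow> (nat \<Rightarrow> complex \<Rightarrow> complex) \<Rightarrow> complex \<Rightarrow> complex mat" where
  "loop_matrix N m z =
     mat N N (\<lambda>(k, l). 1 / of_nat N * (\<Sum>w | w ^ N = z. w powi (- int l) * m k w))"

end

theory Submission
  imports Defs
begin

text \<open>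
  The map \<open>z \<mapsto> z ^ N\<close> preserves Haar measure, and conditioning on its value averages over its
  fibres: \<open>\<integral> G = \<integral> 1/N (\<Sum>w ^ N = z. G w)\<close> (\<open>integral_eq_sum_branches\<close>).  Applied to
  \<open>G z = m z * h (z ^ N) * cnj (f z)\<close> this moves the dilation off \<open>h\<close> and exhibits the adjoint of
  \<open>h \<mapsto> m z * h (z ^ N)\<close> as the transfer operator
  \<open>f \<mapsto> 1/N (\<Sum>w ^ N = z. cnj (m w) * f w)\<close> (\<open>L2_adjoint_wavelet_op\<close>).  In the composition of the
  adjoint for the filter \<open>m\<close> with the wavelet operator for \<open>m'\<close>, the factor \<open>f (w ^ N) = f z\<close> is
  constant on the fibre, so the composition is multiplication by
  \<open>1/N (\<Sum>w ^ N = z. m' w * cnj (m w))\<close>.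

  The rows of a loop matrix at \<open>z\<close> are, up to the factor \<open>1 / sqrt N\<close>, the coefficients of the
  restrictions of the filters to the fibre in the orthonormal basis \<open>w \<mapsto> w ^ l / sqrt N\<close>.  By the
  Parseval identity the multiplier above is therefore an entry of a product of a loop matrix with an
  adjoint (\<open>loop_matrix_mult_adjoint\<close>).  With equal families of filters this is the first claim,
  and for the dual family it gives \<open>B B\<^sup>*\<close>, where \<open>A\<close> and \<open>B\<close> are the loop matrices of the two families.
  For a mixed pair, biorthogonality tested on the constant function \<open>1\<close> says \<open>B A\<^sup>* = 1\<close>
  almost everywhere, and then pure matrix algebra gives \<open>B B\<^sup>* = (A A\<^sup>*)\<^sup>-\<^sup>1\<close>
  (\<open>inverse_gram_matrix\<close>), which is the second claim.
\<close>

section \<open>Branches of the $N$-th root on the circle\<close>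

lemma space_circle_measure [simp]: "space circle_measure = sphere 0 1"
  by (simp add: circle_measure_def space_restrict_space)

lemma sets_circle_measure [measurable_cong]:
  "sets circle_measure = sets (restrict_space borel (sphere 0 1))"
  by (simp add: circle_measure_def)

text \<open>
  The argument is taken in \<open>[0, 2 \<pi>)\<close> so that, in the coordinate \<open>z = cis (2 \<pi> t)\<close> with
  \<open>0 \<le> t < 1\<close> that defines the measure, the \<open>k\<close>-th branch is the affine map
  \<open>t \<mapsto> (t + k) / N\<close>.
\<close>

definition root_branch :: "nat \<Rightarrow> nat \<Rightarrow> complex \<Rightarrow> complex" where
  "root_branch N k z = cis ((Arg2pi z + 2 * pi * real k) / real N)"

lemma norm_root_branch [simp]: "norm (root_branch N k z) = 1"
  by (simp add: root_branch_def)

lemma Arg2pi_cis: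
  assumes "0 \<le> t" "t < 1"
  shows "Arg2pi (cis (2 * pi * t)) = 2 * pi * t"
  by (rule Arg2pi_unique[of 1]) (use assms in \<open>auto simp: cis_conv_exp\<close>)

lemma cis_Arg2pi: "norm z = 1 \<Longrightarrow> cis (Arg2pi z) = z"
  using complex_norm_eq_1_exp[of z] by (simp add: cis_conv_exp)

lemma root_branch_cis:
  assumes "0 \<le> t" "t < 1"
  shows "root_branch N k (cis (2 * pi * t)) = cis (2 * pi * ((t + real k) / real N))"
  using Arg2pi_cis[OF assms] by (simp add: root_branch_def algebra_simps)

lemma root_branch_power:
  assumes "N > 0" "norm z = 1"
  shows "root_branch N k z ^ N = z"
proof -
  have "root_branch N k z ^ N = cis (Arg2pi z + 2 * pi * real k)"
    unfolding root_branch_def Complex.DeMoivre using assms by simp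
  also have "\<dots> = cis (Arg2pi z) * cis (2 * pi * real k)"
    by (rule cis_mult[symmetric])
  also have "cis (2 * pi * real k) = 1"
    by (intro cis_multiple_2pi) simp
  finally show ?thesis using assms by (simp add: cis_Arg2pi)
qed

lemma bij_betw_root_branch:
  assumes "N > 0" "norm z = 1"
  shows "bij_betw (\<lambda>k. root_branch N k z) {..<N} {w. w ^ N = z}"
proof -
  define c where "c = root_branch N 0 z"
  have c: "c ^ N = z"
    unfolding c_def by (rule root_branch_power[OF assms])
  have "norm c = 1" by (simp add: c_def)
  then have "c \<noteq> 0" by auto
  have eq: "root_branch N k z = c * cis (2 * pi * real k / real N)" for k
    by (simp add: root_branch_def c_def cis_mult add_divide_distrib)
  have "z \<noteq> 0" using assms by auto
  have "bij_betw (\<lambda>w. c * w) {w. w ^ N = 1} {w. w ^ N = z}"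
    by (rule bij_betw_byWitness[where f' = "\<lambda>w. w / c"])
       (use c \<open>c \<noteq> 0\<close> \<open>z \<noteq> 0\<close> in \<open>auto simp: power_mult_distrib power_divide\<close>)
  from bij_betw_trans[OF Complex.bij_betw_roots_unity[OF assms(1)] this] show ?thesis
    by (simp add: o_def eq)
qed

text \<open>
  Sums over a fibre are rewritten as sums over branch indices because each branch is a measurable
  function of \<open>z\<close>, whereas the fibre itself varies with \<open>z\<close>.
\<close>

lemma sum_roots_eq_sum_branches:
  fixes F :: "complex \<Rightarrow> 'a::comm_monoid_add"
  assumes "N > 0" "norm z = 1"
  shows "(\<Sum>w | w ^ N = z. F w) = (\<Sum>k<N. F (root_branch N k z))"
  using sum.reindex_bij_betw[OF bij_betw_root_branch[OF assms], of F] by simp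

text \<open>
  The argument jumps along the positive real axis, but from \<open>0\<close> upwards to \<open>2 \<pi>\<close>, so it is lower
  semicontinuous.
\<close>

lemma measurable_Arg2pi [measurable]: "Arg2pi \<in> borel_measurable borel"
  unfolding borel_measurable_iff_greater using open_Arg2pi2pi_gt by auto

lemma measurable_to_circle:
  "f \<in> measurable M borel \<Longrightarrow> (\<And>x. x \<in> space M \<Longrightarrow> norm (f x) = 1) \<Longrightarrow>
     f \<in> measurable M circle_measure"
  unfolding measurable_cong_sets[OF refl sets_circle_measure]
  by (rule measurable_restrict_space2) auto

lemma measurable_from_circle: "f \<in> measurable borel M \<Longrightarrow> f \<in> measurable circle_measure M"
  unfolding measurable_cong_sets[OF sets_circle_measure refl]
  by (rule measurable_restrict_space1)

lemma measurable_root_branch [measurable]: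
  "root_branch N k \<in> measurable circle_measure circle_measure"
proof (rule measurable_to_circle[OF measurable_from_circle])
  have [measurable]: "cis \<in> borel_measurable borel"
    by (intro borel_measurable_continuous_onI continuous_intros)
  show "root_branch N k \<in> borel_measurable borel"
    unfolding root_branch_def by measurable
qed simp

lemma measurable_circle_power [measurable]:
  "(\<lambda>z. z ^ N) \<in> measurable circle_measure circle_measure"
  by (rule measurable_to_circle[OF measurable_from_circle]) (auto simp: norm_power)


section \<open>Integration over the fibres of $z \mapsto z^N$\<close>

lemma has_bochner_integral_circle_iff:
  fixes G :: "complex \<Rightarrow> 'a::{banach, second_countable_topology}"
  assumes [measurable]: "G \<in> borel_measurable circle_measure"
  shows "has_bochner_integral circle_measure G x \<longleftrightarrow>
         has_bochner_integral lborel (\<lambda>t. indicator {0..<1} t *\<^sub>R G (cis (2 * pi * t))) x"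
proof -
  have m: "(\<lambda>t. cis (2 * pi * t)) \<in>
      measurable (restrict_space lborel {0..<1}) (restrict_space borel (sphere 0 1))"
  proof (rule measurable_restrict_space2)
    have "(\<lambda>t. cis (2 * pi * t)) \<in> borel_measurable borel"
      by (intro borel_measurable_continuous_onI continuous_intros)
    then show "(\<lambda>t. cis (2 * pi * t)) \<in> borel_measurable (restrict_space lborel {0..<1})"
      by (intro measurable_restrict_space1) simp
  qed auto
  have G: "G \<in> borel_measurable (restrict_space borel (sphere 0 1))"
    using assms by (simp add: measurable_cong_sets[OF sets_circle_measure refl])
  show ?thesis
    unfolding circle_measure_def has_bochner_integral_iff
      integrable_distr_eq[OF m G] integral_distr[OF m G]
    by (simp add: integrable_restrict_space integral_restrict_space)
qed

text \<open>
  The branches map the circle onto \<open>N\<close> arcs, the images of \<open>[k/N, (k+1)/N)\<close>, which partition it;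
  on each arc the affine substitution \<open>t \<mapsto> (t + k) / N\<close> scales Lebesgue measure by \<open>1/N\<close>.
  The equivalence of integrability is used in both directions: forwards for \<open>f \<circ> b\<^sub>k\<close> and
  backwards for \<open>f (z ^ N)\<close>.
\<close>

lemma integral_over_fibres:
  fixes G :: "complex \<Rightarrow> 'a::{banach, second_countable_topology}"
  assumes N: "N > 0" and G [measurable]: "G \<in> borel_measurable circle_measure"
  shows integrable_iff_branches: "integrable circle_measure G \<longleftrightarrow>
           (\<forall>k<N. integrable circle_measure (\<lambda>z. G (root_branch N k z)))"
    and integral_eq_sum_branches: "integrable circle_measure G \<Longrightarrow>
           integral\<^sup>L circle_measure G =
           (\<Sum>k<N. integral\<^sup>L circle_measure (\<lambda>z. G (root_branch N k z))) /\<^sub>R real N"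
proof -
  define g where "g = (\<lambda>t. indicator {0..<1} t *\<^sub>R G (cis (2 * pi * t)))"
  define I where "I k = {real k / real N ..< (real k + 1) / real N}" for k
  define p where "p k t = indicator (I k) t *\<^sub>R G (cis (2 * pi * t))" for k t
  have piece: "has_bochner_integral circle_measure (\<lambda>z. G (root_branch N k z)) x \<longleftrightarrow>
      has_bochner_integral lborel (p k) (x /\<^sub>R real N)" for k x
  proof -
    have "p k (real k / real N + (1 / real N) * t) =
        indicator {0..<1} t *\<^sub>R G (root_branch N k (cis (2 * pi * t)))" for t
    proof -
      have e: "real k / real N + (1 / real N) * t = (t + real k) / real N"
        by (simp add: add_divide_distrib)
      have "(t + real k) / real N \<in> I k \<longleftrightarrow> t \<in> {0..<1}"
        using N by (auto simp: I_def field_simps)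
      then show ?thesis
        unfolding p_def e by (auto simp: indicator_def root_branch_cis)
    qed
    then have "has_bochner_integral lborel (p k) (x /\<^sub>R real N) \<longleftrightarrow>
        has_bochner_integral lborel
          (\<lambda>t. indicator {0..<1} t *\<^sub>R G (root_branch N k (cis (2 * pi * t)))) x"
      using N lborel_has_bochner_integral_real_affine_iff
        [of "1 / real N" "p k" "x /\<^sub>R real N" "real k / real N"] by simp
    then show ?thesis
      by (subst has_bochner_integral_circle_iff) auto
  qed
  have g_sum: "g = (\<lambda>t. \<Sum>k<N. p k t)"
  proof
    fix t
    show "g t = (\<Sum>k<N. p k t)"
    proof (cases "t \<in> {0..<1}")
      case True
      \<comment> \<open>\<open>k0\<close> is the index of the only arc that contains \<open>t\<close>.\<close>
      define k0 where "k0 = nat \<lfloor>t * real N\<rfloor>"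
      have k0: "real k0 \<le> t * real N" "t * real N < real k0 + 1"
        using True by (auto simp: k0_def)
      have "t * real N < real N" using True N by simp
      then have "k0 < N" using k0 by linarith
      have iff: "t \<in> I k \<longleftrightarrow> k = k0" for k
      proof -
        have "t \<in> I k \<longleftrightarrow> real k \<le> t * real N \<and> t * real N < real k + 1"
          using N by (auto simp: I_def field_simps)
        also have "\<dots> \<longleftrightarrow> k = k0"
          using k0 by auto
        finally show ?thesis .
      qed
      have "(\<Sum>k<N. p k t) = (\<Sum>k<N. if k = k0 then G (cis (2 * pi * t)) else 0)"
        by (intro sum.cong) (auto simp: p_def iff indicator_def)
      also have "\<dots> = G (cis (2 * pi * t))"
        using \<open>k0 < N\<close> by simp
      finally show ?thesis using True by (simp add: g_def)
    next
      case False
      have "t \<notin> I k" if "k < N" for k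
      proof
        assume "t \<in> I k"
        then have t: "real k \<le> t * real N" "t * real N < real k + 1"
          using N by (auto simp: I_def field_simps)
        have "0 \<le> t * real N" using t(1) by linarith
        then have "0 \<le> t" using N by (simp add: zero_le_mult_iff)
        moreover have "t * real N < real N" using t(2) that by linarith
        then have "t < 1" using N by simp
        ultimately show False using False by simp
      qed
      then show ?thesis using False by (simp add: g_def p_def)
    qed
  qed
  have p_g: "p k = (\<lambda>t. indicator (I k) t *\<^sub>R g t)" if "k < N" for k
  proof
    fix t
    have "indicator (I k) t *\<^sub>R g t = (\<Sum>l<N. indicator (I k) t *\<^sub>R p l t)"
      by (simp add: g_sum scaleR_sum_right)
    also have "\<dots> = (\<Sum>l<N. if l = k then p k t else 0)"
    proof (intro sum.cong refl)
      fix l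
      have "l = k" if "t \<in> I k" "t \<in> I l"
      proof -
        have "real k \<le> t * real N" "t * real N < real k + 1"
             "real l \<le> t * real N" "t * real N < real l + 1"
          using that N by (auto simp: I_def field_simps)
        then show ?thesis by linarith
      qed
      then show "indicator (I k) t *\<^sub>R p l t = (if l = k then p k t else 0)"
        by (auto simp: p_def indicator_def)
    qed
    also have "\<dots> = p k t" using that by simp
    finally show "p k t = indicator (I k) t *\<^sub>R g t" by simp
  qed
  have circ: "has_bochner_integral circle_measure G x \<longleftrightarrow> has_bochner_integral lborel g x" for x
    unfolding g_def by (rule has_bochner_integral_circle_iff) fact
  have int_piece: "integrable lborel (p k) \<longleftrightarrow>
      integrable circle_measure (\<lambda>z. G (root_branch N k z))" for k
  proof
    assume "integrable lborel (p k)"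
    then have "has_bochner_integral lborel (p k) ((real N *\<^sub>R integral\<^sup>L lborel (p k)) /\<^sub>R real N)"
      using N by (simp add: has_bochner_integral_integrable)
    then show "integrable circle_measure (\<lambda>z. G (root_branch N k z))"
      unfolding piece[symmetric] by (rule integrable.intros)
  next
    assume "integrable circle_measure (\<lambda>z. G (root_branch N k z))"
    then show "integrable lborel (p k)"
      using piece has_bochner_integral_integrable integrable.intros by blast
  qed
  have int_G: "integrable circle_measure G \<longleftrightarrow> integrable lborel g"
    by (simp add: integrable.simps circ)
  show iff: "integrable circle_measure G \<longleftrightarrow>
           (\<forall>k<N. integrable circle_measure (\<lambda>z. G (root_branch N k z)))"
  proof
    assume "integrable circle_measure G"
    then have "integrable lborel g" by (simp add: int_G)
    then have "integrable lborel (p k)" if "k < N" for k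
      unfolding p_g[OF that] by (intro integrable_mult_indicator) (auto simp: I_def)
    then show "\<forall>k<N. integrable circle_measure (\<lambda>z. G (root_branch N k z))"
      by (simp add: int_piece)
  next
    assume "\<forall>k<N. integrable circle_measure (\<lambda>z. G (root_branch N k z))"
    then have "integrable lborel g"
      unfolding g_sum by (intro Bochner_Integration.integrable_sum) (simp add: int_piece)
    then show "integrable circle_measure G" by (simp add: int_G)
  qed
  assume "integrable circle_measure G"
  then have "has_bochner_integral lborel (p k)
      (integral\<^sup>L circle_measure (\<lambda>z. G (root_branch N k z)) /\<^sub>R real N)" if "k < N" for k
    using that iff unfolding piece[symmetric] by (simp add: has_bochner_integral_integrable)
  then have "has_bochner_integral lborel g
      (\<Sum>k<N. integral\<^sup>L circle_measure (\<lambda>z. G (root_branch N k z)) /\<^sub>R real N)"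
    unfolding g_sum by (intro has_bochner_integral_sum) auto
  then have "has_bochner_integral circle_measure G
      (\<Sum>k<N. integral\<^sup>L circle_measure (\<lambda>z. G (root_branch N k z)) /\<^sub>R real N)"
    by (simp add: circ)
  then show "integral\<^sup>L circle_measure G =
      (\<Sum>k<N. integral\<^sup>L circle_measure (\<lambda>z. G (root_branch N k z))) /\<^sub>R real N"
    by (simp add: has_bochner_integral_integral_eq scaleR_sum_right)
qed

lemma finite_measure_circle: "finite_measure circle_measure"
proof
  have "has_bochner_integral lborel (\<lambda>t::real. indicator {0..<1} t *\<^sub>R (1::real)) 1"
    using has_bochner_integral_real_indicator[of "{0..<1::real}" lborel] by simp
  then have "has_bochner_integral circle_measure (\<lambda>_. 1::real) 1"
    by (subst has_bochner_integral_circle_iff) simp_all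
  then have "integrable circle_measure (\<lambda>_. 1::real)" by (rule integrable.intros)
  then show "emeasure circle_measure (space circle_measure) \<noteq> \<infinity>"
    by (simp add: integrable_iff_bounded less_top)
qed


section \<open>Square-integrable functions\<close>

lemma L2_circleD:
  assumes "f \<in> L2_circle"
  shows "f \<in> borel_measurable circle_measure" "integrable circle_measure (\<lambda>z. (norm (f z))\<^sup>2)"
  using assms by (auto simp: L2_circle_def)

lemma L2_circle_dominated:
  assumes "f \<in> L2_circle" "g \<in> borel_measurable circle_measure"
    and "AE z in circle_measure. norm (g z) \<le> C * norm (f z)"
  shows "g \<in> L2_circle"
proof -
  note [measurable] = assms(2) L2_circleD(1)[OF assms(1)]
  have "integrable circle_measure (\<lambda>z. C\<^sup>2 * (norm (f z))\<^sup>2)"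
    using L2_circleD(2)[OF assms(1)] by simp
  then have "integrable circle_measure (\<lambda>z. (norm (g z))\<^sup>2)"
  proof (rule Bochner_Integration.integrable_bound)
    show "AE z in circle_measure. norm ((norm (g z))\<^sup>2) \<le> norm (C\<^sup>2 * (norm (f z))\<^sup>2)"
      using assms(3)
    proof eventually_elim
      case (elim z)
      then have "(norm (g z))\<^sup>2 \<le> (C * norm (f z))\<^sup>2" by (intro power_mono) auto
      then show ?case by (simp add: power_mult_distrib)
    qed
  qed measurable
  then show ?thesis using assms(2) by (simp add: L2_circle_def)
qed

lemma L2_circle_add:
  assumes "f \<in> L2_circle" "g \<in> L2_circle"
  shows "(\<lambda>z. f z + g z) \<in> L2_circle"
proof -
  note [measurable] = L2_circleD(1)[OF assms(1)] L2_circleD(1)[OF assms(2)]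
  have "integrable circle_measure (\<lambda>z. 2 * (norm (f z))\<^sup>2 + 2 * (norm (g z))\<^sup>2)"
    using assms[THEN L2_circleD(2)] by simp
  then have "integrable circle_measure (\<lambda>z. (norm (f z + g z))\<^sup>2)"
  proof (rule Bochner_Integration.integrable_bound)
    have "(norm (f z + g z))\<^sup>2 \<le> 2 * (norm (f z))\<^sup>2 + 2 * (norm (g z))\<^sup>2" for z
    proof -
      have "(norm (f z + g z))\<^sup>2 \<le> (norm (f z) + norm (g z))\<^sup>2"
        by (intro power_mono norm_triangle_ineq) auto
      also have "\<dots> \<le> 2 * (norm (f z))\<^sup>2 + 2 * (norm (g z))\<^sup>2"
        using sum_squares_bound[of "norm (f z)" "norm (g z)"] by (simp add: power2_sum)
      finally show ?thesis .
    qed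
    then show "AE z in circle_measure. norm ((norm (f z + g z))\<^sup>2)
        \<le> norm (2 * (norm (f z))\<^sup>2 + 2 * (norm (g z))\<^sup>2)" by simp
  qed measurable
  then show ?thesis by (simp add: L2_circle_def)
qed

lemma L2_circle_zero: "(\<lambda>_. 0) \<in> L2_circle"
  by (simp add: L2_circle_def)

lemma L2_circle_const: "(\<lambda>_. c) \<in> L2_circle"
  using finite_measure.integrable_const[OF finite_measure_circle] by (simp add: L2_circle_def)

lemma L2_circle_sum:
  assumes "\<And>k. k \<in> I \<Longrightarrow> f k \<in> L2_circle"
  shows "(\<lambda>z. \<Sum>k\<in>I. f k z) \<in> L2_circle"
  using assms
  by (induction I rule: infinite_finite_induct) (auto intro: L2_circle_zero L2_circle_add)

lemma L2_circle_cmult: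
  assumes "f \<in> L2_circle"
  shows "(\<lambda>z. c * f z) \<in> L2_circle"
  using L2_circleD(1)[OF assms]
  by (intro L2_circle_dominated[OF assms, of _ "norm c"]) (auto simp: norm_mult)

lemma Linf_mult_L2_circle:
  assumes "m \<in> Linf_circle" "f \<in> L2_circle"
  shows "(\<lambda>z. m z * f z) \<in> L2_circle"
proof -
  obtain C where C: "AE z in circle_measure. norm (m z) \<le> C"
    and [measurable]: "m \<in> borel_measurable circle_measure"
    using assms(1) by (auto simp: Linf_circle_def)
  note [measurable] = L2_circleD(1)[OF assms(2)]
  from C have "AE z in circle_measure. norm (m z * f z) \<le> C * norm (f z)"
    by eventually_elim (auto simp: norm_mult intro: mult_right_mono)
  then show ?thesis by (intro L2_circle_dominated[OF assms(2)]) auto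
qed

lemma measurable_cnj [measurable]: "cnj \<in> borel_measurable borel"
  by (intro borel_measurable_continuous_onI continuous_intros)

lemma L2_circle_cnj: "f \<in> L2_circle \<Longrightarrow> (\<lambda>z. cnj (f z)) \<in> L2_circle"
  using measurable_compose[OF _ measurable_cnj] by (auto simp: L2_circle_def)

lemma integrable_L2_mult:
  assumes "f \<in> L2_circle" "g \<in> L2_circle"
  shows "integrable circle_measure (\<lambda>z. f z * g z)"
proof -
  note [measurable] = L2_circleD(1)[OF assms(1)] L2_circleD(1)[OF assms(2)]
  have "integrable circle_measure (\<lambda>z. (norm (f z))\<^sup>2 + (norm (g z))\<^sup>2)"
    using assms by (auto dest: L2_circleD)
  then show ?thesis
  proof (rule Bochner_Integration.integrable_bound)
    have "norm (f z) * norm (g z) \<le> (norm (f z))\<^sup>2 + (norm (g z))\<^sup>2" for z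
    proof -
      have "0 \<le> norm (f z) * norm (g z)" by simp
      then show ?thesis
        using sum_squares_bound[of "norm (f z)" "norm (g z)"] by linarith
    qed
    then show "AE z in circle_measure. norm (f z * g z) \<le> norm ((norm (f z))\<^sup>2 + (norm (g z))\<^sup>2)"
      by (simp add: norm_mult)
  qed measurable
qed

lemma L2_circle_branch:
  assumes "N > 0" "k < N" "f \<in> L2_circle"
  shows "(\<lambda>z. f (root_branch N k z)) \<in> L2_circle"
proof -
  note [measurable] = L2_circleD(1)[OF assms(3)]
  have "integrable circle_measure (\<lambda>z. (norm (f (root_branch N k z)))\<^sup>2)"
    using integrable_iff_branches[OF assms(1), of "\<lambda>z. (norm (f z))\<^sup>2"]
      L2_circleD(2)[OF assms(3)] assms(2) by simp
  then show ?thesis by (simp add: L2_circle_def)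
qed

text \<open>
  On every branch \<open>f (z ^ N)\<close> becomes \<open>f\<close> itself.
\<close>

lemma L2_circle_power:
  assumes "N > 0" "f \<in> L2_circle"
  shows "(\<lambda>z. f (z ^ N)) \<in> L2_circle"
proof -
  note [measurable] = L2_circleD(1)[OF assms(2)]
  have "integrable circle_measure (\<lambda>z. (norm (f (root_branch N k z ^ N)))\<^sup>2)" for k
    using L2_circleD(2)[OF assms(2)]
    by (subst Bochner_Integration.integrable_cong[OF refl, where g = "\<lambda>z. (norm (f z))\<^sup>2"])
       (auto simp: root_branch_power[OF assms(1)])
  then have "integrable circle_measure (\<lambda>z. (norm (f (z ^ N)))\<^sup>2)"
    by (subst integrable_iff_branches[OF assms(1)]) auto
  then show ?thesis by (simp add: L2_circle_def)
qed

lemma wavelet_op_L2: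
  assumes "N > 0" "m \<in> Linf_circle" "f \<in> L2_circle"
  shows "wavelet_op N m f \<in> L2_circle"
  unfolding wavelet_op_def
  by (intro Linf_mult_L2_circle assms L2_circle_power)


section \<open>The adjoint of a wavelet operator\<close>

text \<open>
  Known as the Ruelle or transfer operator with weight \<open>cnj m\<close>; it is an average over the fibre of
  \<open>z \<mapsto> z ^ N\<close>.
\<close>

definition transfer_op ::
  "nat \<Rightarrow> (complex \<Rightarrow> complex) \<Rightarrow> (complex \<Rightarrow> complex) \<Rightarrow> (complex \<Rightarrow> complex)" where
  "transfer_op N m f z =
     1 / of_nat N * (\<Sum>k<N. cnj (m (root_branch N k z)) * f (root_branch N k z))"

lemma transfer_op_L2:
  assumes "N > 0" "m \<in> Linf_circle" "f \<in> L2_circle"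
  shows "transfer_op N m f \<in> L2_circle"
proof -
  have "(\<lambda>z. cnj (m z)) \<in> Linf_circle"
    using assms(2) measurable_compose[OF _ measurable_cnj] by (auto simp: Linf_circle_def)
  then have "(\<lambda>z. cnj (m z) * f z) \<in> L2_circle"
    using assms(3) by (rule Linf_mult_L2_circle)
  then have "(\<lambda>z. \<Sum>k<N. cnj (m (root_branch N k z)) * f (root_branch N k z)) \<in> L2_circle"
    using L2_circle_branch[OF assms(1)] by (intro L2_circle_sum) auto
  then show ?thesis
    unfolding transfer_op_def[abs_def] by (rule L2_circle_cmult)
qed

text \<open>
  Averaging \<open>m z * h (z ^ N) * cnj (f z)\<close> over a fibre leaves the factor \<open>h\<close> outside the average.
\<close>

lemma L2_inner_wavelet_op:
  assumes N: "N > 0" and m: "m \<in> Linf_circle" and f: "f \<in> L2_circle" and h: "h \<in> L2_circle"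
  shows "L2_inner (wavelet_op N m h) f = L2_inner h (transfer_op N m f)"
proof -
  let ?b = "root_branch N"
  define G where "G = (\<lambda>z. m z * h (z ^ N) * cnj (f z))"
  have int: "integrable circle_measure G"
    using integrable_L2_mult[OF wavelet_op_L2[OF N m h] L2_circle_cnj[OF f]]
    by (simp add: G_def wavelet_op_def)
  then have meas: "G \<in> borel_measurable circle_measure" by auto
  have int_b: "integrable circle_measure (\<lambda>z. G (?b k z))" if "k < N" for k
    using integrable_iff_branches[OF N meas] int that by auto
  have "L2_inner (wavelet_op N m h) f = integral\<^sup>L circle_measure G"
    by (simp add: L2_inner_def G_def wavelet_op_def)
  also have "\<dots> = (\<Sum>k<N. LINT z|circle_measure. G (?b k z)) /\<^sub>R real N"
    by (rule integral_eq_sum_branches[OF N meas int])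
  also have "\<dots> = (LINT z|circle_measure. (\<Sum>k<N. G (?b k z)) /\<^sub>R real N)"
    using int_b by (simp add: Bochner_Integration.integral_sum)
  also have "\<dots> = (LINT z|circle_measure. h z * cnj (transfer_op N m f z))"
  proof (rule Bochner_Integration.integral_cong[OF refl])
    fix z assume "z \<in> space circle_measure"
    then have "?b k z ^ N = z" for k by (auto simp: root_branch_power[OF N])
    then show "(\<Sum>k<N. G (?b k z)) /\<^sub>R real N = h z * cnj (transfer_op N m f z)"
      by (simp add: G_def transfer_op_def scaleR_conv_of_real sum_distrib_left
          field_simps sum_divide_distrib)
  qed
  finally show ?thesis by (simp add: L2_inner_def)
qed

text \<open>
  Testing against \<open>h = g - g'\<close> makes the norm of the difference vanish.
\<close>

lemma L2_inner_unique:
  assumes g: "g \<in> L2_circle" and g': "g' \<in> L2_circle"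
    and eq: "\<And>h. h \<in> L2_circle \<Longrightarrow> L2_inner h g = L2_inner h g'"
  shows "AE z in circle_measure. g z = g' z"
proof -
  define d where "d = (\<lambda>z. g z + (- 1) * g' z)"
  have d: "d \<in> L2_circle"
    unfolding d_def by (intro L2_circle_add L2_circle_cmult g g')
  have "(LINT z|circle_measure. d z * cnj (d z)) = L2_inner d g - L2_inner d g'"
    unfolding L2_inner_def
    by (subst Bochner_Integration.integral_diff[symmetric])
       (auto intro!: integrable_L2_mult L2_circle_cnj d g g' simp: d_def algebra_simps)
  also have "\<dots> = 0" using eq[OF d] by simp
  finally have "(LINT z|circle_measure. complex_of_real ((norm (d z))\<^sup>2)) = 0"
    by (simp only: complex_norm_square)
  then have "(LINT z|circle_measure. (norm (d z))\<^sup>2) = 0"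
    by (simp only: integral_complex_of_real of_real_eq_0_iff)
  then have "AE z in circle_measure. (norm (d z))\<^sup>2 = 0"
    by (subst (asm) integral_nonneg_eq_0_iff_AE[OF L2_circleD(2)[OF d]]) auto
  then show ?thesis by eventually_elim (simp add: d_def)
qed

text \<open>
  The adjoint is a chosen representative, so it agrees with the transfer operator only almost
  everywhere.
\<close>

lemma L2_adjoint_wavelet_op:
  assumes "N > 0" "m \<in> Linf_circle" "f \<in> L2_circle"
  shows "AE z in circle_measure. L2_adjoint (wavelet_op N m) f z = transfer_op N m f z"
proof -
  let ?P = "\<lambda>g. g \<in> L2_circle \<and> (\<forall>h\<in>L2_circle. L2_inner (wavelet_op N m h) f = L2_inner h g)"
  have tr: "?P (transfer_op N m f)"
    using L2_inner_wavelet_op[OF assms] transfer_op_L2[OF assms] by auto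
  then have "?P (L2_adjoint (wavelet_op N m) f)"
    unfolding L2_adjoint_def by (rule someI[where P = ?P])
  with tr show ?thesis by (intro L2_inner_unique) auto
qed

text \<open>
  On the fibre over \<open>z\<close> the factor \<open>f (w ^ N)\<close> is the constant \<open>f z\<close>, so the composition is a
  multiplication operator.
\<close>

lemma L2_adjoint_wavelet_op_wavelet_op:
  assumes N: "N > 0" and "m \<in> Linf_circle" "m' \<in> Linf_circle" "f \<in> L2_circle"
  shows "AE z in circle_measure. L2_adjoint (wavelet_op N m) (wavelet_op N m' f) z =
           1 / of_nat N * (\<Sum>w | w ^ N = z. m' w * cnj (m w)) * f z"
  using L2_adjoint_wavelet_op[OF N assms(2) wavelet_op_L2[OF N assms(3,4)]] AE_space
proof eventually_elim
  case (elim z)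
  then have z: "norm z = 1" by auto
  have "transfer_op N m (wavelet_op N m' f) z =
      1 / of_nat N * (\<Sum>k<N. m' (root_branch N k z) * cnj (m (root_branch N k z))) * f z"
    by (simp add: transfer_op_def wavelet_op_def root_branch_power[OF N z] sum_distrib_left mult_ac)
  then show ?case
    using elim by (simp only: sum_roots_eq_sum_branches[OF N z])
qed


section \<open>Loop matrices\<close>

lemma mat_adjoint_carrier: "A \<in> carrier_mat n n \<Longrightarrow> mat_adjoint A \<in> carrier_mat n n"
  by (auto simp: mat_adjoint_def)

lemma mult_mat_adjoint_index:
  fixes A B :: "complex mat"
  assumes "A \<in> carrier_mat n n" "B \<in> carrier_mat n n" "j < n" "i < n"
  shows "(A * mat_adjoint B) $$ (j, i) = (\<Sum>l<n. A $$ (j, l) * cnj (B $$ (i, l)))"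
  using assms by (auto simp: mat_adjoint_def scalar_prod_def mat_of_rows_def lessThan_atLeast0)

lemma loop_matrix_carrier [simp]: "loop_matrix N m z \<in> carrier_mat N N"
  by (simp add: loop_matrix_def)

text \<open>
  Orthogonality of characters: \<open>v / w\<close> is an \<open>N\<close>-th root of unity, and a geometric sum over a
  nontrivial one vanishes.
\<close>

lemma sum_powi_roots:
  fixes w v :: complex
  assumes N: "N > 0" and w: "w ^ N = z" and v: "v ^ N = z" and z: "norm z = 1"
  shows "(\<Sum>l<N. w powi (- int l) * cnj (v powi (- int l))) = (if w = v then of_nat N else 0)"
proof -
  have root_norm: "norm u = 1" if "u ^ N = z" for u
  proof -
    have "norm u ^ N = 1" using that z by (metis norm_power)
    then show ?thesis using N power_eq_1_iff[of "norm u" N] by auto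
  qed
  have n: "norm w = 1" "norm v = 1" using root_norm w v by auto
  then have nz: "w \<noteq> 0" "v \<noteq> 0" by auto
  have cv: "cnj v = inverse v"
    using complex_norm_square[of v] n(2) by (intro inverse_unique[symmetric]) simp
  have "w powi (- int l) * cnj (v powi (- int l)) = (v / w) ^ l" for l
    by (simp add: power_int_minus cv field_simps)
  then have *: "(\<Sum>l<N. w powi (- int l) * cnj (v powi (- int l))) = (\<Sum>l<N. (v / w) ^ l)" by simp
  show ?thesis
  proof (cases "w = v")
    case True
    then show ?thesis unfolding * using nz by simp
  next
    case False
    then have "v / w \<noteq> 1" using nz by auto
    moreover have "(v / w) ^ N = 1" using w v z by (auto simp: power_divide)
    ultimately show ?thesis unfolding * using False by (simp add: geometric_sum)
  qed
qed

text \<open>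
  Parseval's identity on the fibre: expanding both entries and summing over the column index first,
  orthogonality leaves only the diagonal terms of the double sum over the fibre, with a factor
  \<open>N\<close> that cancels one of the two normalizations \<open>1/N\<close>.
\<close>

lemma loop_matrix_mult_adjoint:
  assumes N: "N > 0" and z: "norm z = 1" and "j < N" "i < N"
  shows "(loop_matrix N m z * mat_adjoint (loop_matrix N m' z)) $$ (j, i) =
         1 / of_nat N * (\<Sum>w | w ^ N = z. m j w * cnj (m' i w))"
proof -
  let ?R = "{w. w ^ N = z}"
  have fin: "finite ?R" using bij_betw_finite[OF bij_betw_root_branch[OF N z]] by simp
  have "(loop_matrix N m z * mat_adjoint (loop_matrix N m' z)) $$ (j, i) =
     (\<Sum>l<N. (1 / of_nat N * (\<Sum>w\<in>?R. w powi (- int l) * m j w)) *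
             cnj (1 / of_nat N * (\<Sum>v\<in>?R. v powi (- int l) * m' i v)))"
    using assms by (subst mult_mat_adjoint_index[of _ N]) (simp_all add: loop_matrix_def)
  also have "\<dots> = (\<Sum>l<N. 1 / (of_nat N)\<^sup>2 * (\<Sum>w\<in>?R. \<Sum>v\<in>?R.
       (w powi (- int l) * m j w) * cnj (v powi (- int l) * m' i v)))"
    unfolding sum_product[symmetric] by (simp add: power2_eq_square)
  also have "\<dots> = 1 / (of_nat N)\<^sup>2 * (\<Sum>l<N. \<Sum>w\<in>?R. \<Sum>v\<in>?R.
       m j w * cnj (m' i v) * (w powi (- int l) * cnj (v powi (- int l))))"
    unfolding sum_distrib_left by (intro sum.cong refl) (simp add: mult_ac)
  also have "(\<Sum>l<N. \<Sum>w\<in>?R. \<Sum>v\<in>?R.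
       m j w * cnj (m' i v) * (w powi (- int l) * cnj (v powi (- int l)))) =
     (\<Sum>w\<in>?R. \<Sum>v\<in>?R. m j w * cnj (m' i v) *
       (\<Sum>l<N. w powi (- int l) * cnj (v powi (- int l))))"
    by (subst sum.swap, intro sum.cong refl, subst sum.swap)
       (simp add: sum_distrib_left)
  also have "\<dots> = (\<Sum>w\<in>?R. \<Sum>v\<in>?R. if w = v then of_nat N * (m j w * cnj (m' i v)) else 0)"
    by (intro sum.cong refl, subst sum_powi_roots[OF N _ _ z]) auto
  also have "\<dots> = of_nat N * (\<Sum>w\<in>?R. m j w * cnj (m' i w))"
    using fin by (simp add: sum_distrib_left)
  finally show ?thesis by (simp add: power2_eq_square)
qed

lemma L2_adjoint_eq_loop_matrix_entry:
  assumes N: "N > 0" and "m' i \<in> Linf_circle" "m j \<in> Linf_circle" "f \<in> L2_circle"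
    and "i < N" "j < N"
  shows "AE z in circle_measure. L2_adjoint (wavelet_op N (m' i)) (wavelet_op N (m j) f) z =
           (loop_matrix N m z * mat_adjoint (loop_matrix N m' z)) $$ (j, i) * f z"
  using L2_adjoint_wavelet_op_wavelet_op[OF assms(1-4)] AE_space
  by eventually_elim (use assms in \<open>auto simp: loop_matrix_mult_adjoint\<close>)

text \<open>
  Testing the biorthogonality relations on the constant function \<open>1\<close> reads off the multipliers.
  The exceptional null sets depend on the pair of indices, but there are finitely many pairs.
\<close>

lemma biorthogonal_loop_matrix:
  assumes N: "N > 0" and "biorthogonal_wavelet_rep N m mt"
  shows "AE z in circle_measure. loop_matrix N mt z * mat_adjoint (loop_matrix N m z) = 1\<^sub>m N"
proof -
  have Linf: "m i \<in> Linf_circle" "mt i \<in> Linf_circle" if "i < N" for i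
    using assms(2) that by (auto simp: biorthogonal_wavelet_rep_def)
  have "AE z in circle_measure.
      (loop_matrix N mt z * mat_adjoint (loop_matrix N m z)) $$ (j, i) = (if i = j then 1 else 0)"
    if ij: "i < N" "j < N" for i j
  proof -
    have "AE z in circle_measure.
        L2_adjoint (wavelet_op N (m i)) (wavelet_op N (mt j) (\<lambda>_. 1)) z = (if i = j then 1 else 0)"
      using assms(2) ij L2_circle_const[of 1] unfolding biorthogonal_wavelet_rep_def by blast
    then show ?thesis
      using L2_adjoint_eq_loop_matrix_entry[of N m i mt j "\<lambda>_. 1", OF N Linf(1) Linf(2)
          L2_circle_const] ij by auto
  qed
  then have "AE z in circle_measure. \<forall>i\<in>{..<N}. \<forall>j\<in>{..<N}.
      (loop_matrix N mt z * mat_adjoint (loop_matrix N m z)) $$ (j, i) = (if i = j then 1 else 0)"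
    by (simp add: AE_finite_all)
  then show ?thesis
  proof eventually_elim
    case (elim z)
    have "loop_matrix N mt z * mat_adjoint (loop_matrix N m z) \<in> carrier_mat N N"
      by (intro mult_carrier_mat[of _ N N] mat_adjoint_carrier) auto
    with elim show ?case by (intro eq_matI) auto
  qed
qed

text \<open>
  A one-sided inverse of a square matrix is two-sided, so \<open>A\<^sup>* B = 1\<close>, and the adjoint of the
  hypothesis is \<open>A B\<^sup>* = 1\<close>.  Hence \<open>(A A\<^sup>*) (B B\<^sup>*) = A (A\<^sup>* B) B\<^sup>* = A B\<^sup>* = 1\<close>.
\<close>

lemma inverse_gram_matrix:
  fixes A B :: "complex mat"
  assumes A: "A \<in> carrier_mat n n" and B: "B \<in> carrier_mat n n"
    and BA: "B * mat_adjoint A = 1\<^sub>m n"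
  shows "mat_inverse (A * mat_adjoint A) = Some (B * mat_adjoint B)"
proof -
  note [simp] = mat_adjoint_carrier[OF A] mat_adjoint_carrier[OF B] A B
  define G H where "G = A * mat_adjoint A" and "H = B * mat_adjoint B"
  have G: "G \<in> carrier_mat n n" and H: "H \<in> carrier_mat n n"
    by (auto simp: G_def H_def intro!: mult_carrier_mat[of _ n n])
  have AB: "A * mat_adjoint B = 1\<^sub>m n"
  proof (rule eq_matI)
    fix i j assume ij: "i < dim_row (1\<^sub>m n :: complex mat)" "j < dim_col (1\<^sub>m n :: complex mat)"
    then have "(A * mat_adjoint B) $$ (i, j) = cnj ((B * mat_adjoint A) $$ (j, i))"
      by (simp add: mult_mat_adjoint_index[OF A B] mult_mat_adjoint_index[OF B A] mult.commute
          del: index_mult_mat)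
    also have "\<dots> = 1\<^sub>m n $$ (i, j)" using ij by (simp add: BA)
    finally show "(A * mat_adjoint B) $$ (i, j) = 1\<^sub>m n $$ (i, j)" .
  qed (simp_all add: carrier_matD(1)[OF A] carrier_matD(2)[OF mat_adjoint_carrier[OF B]])
  have "mat_adjoint A * B = 1\<^sub>m n"
    by (rule mat_mult_left_right_inverse[OF B mat_adjoint_carrier[OF A] BA])
  then have GH: "G * H = 1\<^sub>m n"
  proof -
    have "G * H = A * ((mat_adjoint A * B) * mat_adjoint B)"
      unfolding G_def H_def
      by (simp add: assoc_mult_mat[of _ n n _ n _ n] mult_carrier_mat[of _ n n])
    then show ?thesis using \<open>mat_adjoint A * B = 1\<^sub>m n\<close> AB
      by (simp add: left_mult_one_mat[OF mat_adjoint_carrier[OF B]])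
  qed
  have HG: "H * G = 1\<^sub>m n" by (rule mat_mult_left_right_inverse[OF G H GH])
  have "G \<in> Units (ring_mat TYPE(complex) n ())"
    using G H GH HG by (auto simp: Units_def ring_mat_def)
  then obtain K where K: "mat_inverse G = Some K"
    using mat_inverse(1)[OF G, where b = "()"] by (cases "mat_inverse G") auto
  then have KG: "K * G = 1\<^sub>m n" and Kc: "K \<in> carrier_mat n n"
    using mat_inverse(2)[OF G] by auto
  have "K = K * (G * H)" using Kc by (simp add: GH)
  also have "\<dots> = (K * G) * H" using assoc_mult_mat[OF Kc G H] by simp
  also have "\<dots> = H" using H by (simp add: KG)
  finally show ?thesis using K by (simp add: G_def H_def)
qed

theorem lemma3p5:
  fixes N :: nat
    and m mt :: "nat \<Rightarrow> complex \<Rightarrow> complex"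
    and S St :: "nat \<Rightarrow> (complex \<Rightarrow> complex) \<Rightarrow> (complex \<Rightarrow> complex)"
    and A :: "complex \<Rightarrow> complex mat"
    and f :: "complex \<Rightarrow> complex"
    and i j :: nat
  assumes "N \<ge> 2"
    and "biorthogonal_wavelet_rep N m mt"
    and "\<And>k. k < N \<Longrightarrow> S k = wavelet_op N (m k)"
    and "\<And>k. k < N \<Longrightarrow> St k = wavelet_op N (mt k)"
    and "\<And>z. A z = loop_matrix N m z"
    and "f \<in> L2_circle"
    and "i < N" and "j < N"
  shows "(AE z in circle_measure.
            L2_adjoint (S i) (S j f) z = (A z * mat_adjoint (A z)) $$ (j, i) * f z) \<and>
         (AE z in circle_measure.
            \<exists>B. mat_inverse (A z * mat_adjoint (A z)) = Some B \<and>
                L2_adjoint (St i) (St j f) z = B $$ (j, i) * f z)"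
proof -
  have N: "N > 0" using assms(1) by simp
  have Linf: "m k \<in> Linf_circle" "mt k \<in> Linf_circle" if "k < N" for k
    using assms(2) that by (auto simp: biorthogonal_wavelet_rep_def)
  have i: "AE z in circle_measure.
      L2_adjoint (S i) (S j f) z = (A z * mat_adjoint (A z)) $$ (j, i) * f z"
    using L2_adjoint_eq_loop_matrix_entry[of N m i m j f] N Linf assms by simp
  have "AE z in circle_measure. L2_adjoint (St i) (St j f) z =
      (loop_matrix N mt z * mat_adjoint (loop_matrix N mt z)) $$ (j, i) * f z"
    using L2_adjoint_eq_loop_matrix_entry[of N mt i mt j f] N Linf assms by simp
  with biorthogonal_loop_matrix[OF N assms(2)]
  have "AE z in circle_measure. \<exists>B. mat_inverse (A z * mat_adjoint (A z)) = Some B \<and>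
      L2_adjoint (St i) (St j f) z = B $$ (j, i) * f z"
  proof eventually_elim
    case (elim z)
    have "mat_inverse (A z * mat_adjoint (A z)) =
        Some (loop_matrix N mt z * mat_adjoint (loop_matrix N mt z))"
      unfolding assms(5) by (rule inverse_gram_matrix[of _ N]) (use elim in auto)
    then show ?case using elim by blast
  qed
  with i show ?thesis by blast
qed

end
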